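(* For any integers $m\ge 3$ and $n\ge 2m+1$, all complex roots of the polynomial $f_{m,n}(z)=\sum_{j=0}^{n}\binom{n}{j}z^{\binom{j}{m}}$ satisfy $$|z|<1+\frac{m!}{(n-m)^{m-2}}.$$
   Context: Conventions: $\binom{j}{m}=0$ for $0\le j<m$, and $z^0=1$. *)

theory Defs
  imports Complex_Main "HOL-Computational_Algebra.Polynomial"
begin

(* The exponents j choose m vanish for j < m, so the terms with j < m all
   contribute to the constant coefficient. *)
definition f_poly :: "nat \<Rightarrow> nat \<Rightarrow> complex poly" where
  "f_poly m n = (\<Sum>j=0..n. monom (of_nat (n choose j)) (j choose m))"

end

theory Submission
  imports Defs "HOL-Analysis.Convex"
begin

text \<open>
  Put \<open>r = |z|\<close> and \<open>t = r powr ((n choose m) / n)\<close>. Since \<open>(j choose m) / j\<close> is increasing in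
  \<open>j\<close>, every non-leading term is dominated by \<open>(n choose j) * t ^ j\<close>, so a root with \<open>r \<ge> 1\<close>
  satisfies \<open>t ^ n \<le> (1 + t) ^ n - t ^ n\<close>. This forces \<open>t \<le> 2 * n\<close>, whereas
  \<open>r \<ge> 1 + m! / (n - m) ^ (m - 2)\<close> makes \<open>t\<close> quadratically large in \<open>n\<close> by Bernoulli's inequality.
\<close>

text \<open>Weighted AM-GM for \<open>1 + a * x\<close> and \<open>1\<close> with weights
  \<open>1 / a\<close> and \<open>1 - 1 / a\<close>, raised to the power \<open>a\<close>.\<close>

lemma Bernoulli_inequality_powr:
  fixes x a :: real
  assumes "0 \<le> x" "1 \<le> a"
  shows "1 + a * x \<le> (1 + x) powr a"
proof -
  have "(1 + a * x) powr (1 / a) * 1 powr (1 - 1 / a)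
      \<le> (1 / a) * (1 + a * x) + (1 - 1 / a) * 1"
    using assms by (intro Youngs_inequality_0) (auto simp: add_pos_nonneg)
  also have "\<dots> = 1 + x"
    using assms by (simp add: field_simps)
  finally have "((1 + a * x) powr (1 / a)) powr a \<le> (1 + x) powr a"
    using assms by (intro powr_mono2) auto
  then show ?thesis
    using assms by (simp add: powr_powr add_nonneg_nonneg)
qed

text \<open>By absorption, \<open>(j choose m) / j\<close> equals
  \<open>(j - 1 choose (m - 1)) / m\<close>, which is monotone in \<open>j\<close>. The
  cross-multiplied form also covers \<open>j = 0\<close>.\<close>

lemma times_binomial_le_times_binomial:
  assumes "m \<ge> 1" "j \<le> n"
  shows "n * (j choose m) \<le> j * (n choose m)"
proof -
  have "m * (n * (j choose m)) = n * j * (j - 1 choose (m - 1))"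
    using times_binomial_minus1_eq[of m j] assms by simp
  also have "\<dots> \<le> n * j * (n - 1 choose (m - 1))"
    using assms by (intro mult_le_mono2 binomial_right_mono) simp
  also have "\<dots> = m * (j * (n choose m))"
    using times_binomial_minus1_eq[of m n] assms by simp
  finally show ?thesis
    using assms by simp
qed

text \<open>The right-hand side is the falling factorial of \<open>n\<close> with \<open>m\<close>
  factors. The first two are kept exactly, and each of the other \<open>m - 2\<close> is at least
  \<open>n - m\<close>.\<close>

lemma fact_times_binomial_ge:
  fixes n m :: nat
  assumes "2 \<le> m" "m \<le> n"
  shows "n * (n - 1) * (n - m) ^ (m - 2) \<le> fact m * (n choose m)"
  using assms
proof (induction m rule: dec_induct)
  case base
  have "fact 2 * (n choose 2) = n * (n - 1)"
    unfolding choose_two by (cases n) simp_all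
  then show ?case by simp
next
  case (step k)
  have "n * (n - 1) * (n - Suc k) ^ (Suc k - 2)
      = n * (n - 1) * (n - Suc k) ^ (k - 2) * (n - Suc k)"
    using step power_minus_mult[of "k - 1" "n - Suc k"] by (simp add: numeral_2_eq_2)
  also have "\<dots> \<le> n * (n - 1) * (n - k) ^ (k - 2) * (n - k)"
    by (intro mult_le_mono power_mono) auto
  also have "\<dots> \<le> fact k * (n choose k) * (n - k)"
    using step by (intro mult_le_mono1) simp
  \<comment> \<open>Both absorption identities rewrite \<open>n\<close> times a binomial coefficient
    of \<open>n - 1\<close>, so
    \<open>(n - k) * (n choose k) = Suc k * (n choose Suc k)\<close>.\<close>
  also have "\<dots> = fact (Suc k) * (n choose Suc k)"
    using binomial_absorb_comp[of n k] binomial_absorption[of k n]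
    by (simp add: fact_Suc mult.assoc mult.left_commute mult.commute[of "n choose k"]
        del: binomial_Suc_Suc mult_Suc)
  finally show ?case .
qed

lemma binomial_ge_double:
  fixes n m :: nat
  assumes "2 \<le> m" "2 * m + 1 \<le> n"
  shows "2 * n \<le> n choose m"
proof -
  have "n * 4 \<le> n * (n - 1)"
    using assms by (intro mult_le_mono2) simp
  then have "2 * n \<le> n choose 2"
    unfolding choose_two by linarith
  also have "\<dots> \<le> n choose m"
    using assms by (intro binomial_mono) auto
  finally show ?thesis .
qed

lemma power_binomial_le:
  fixes r :: real
  assumes "1 \<le> r" "1 \<le> m" "j \<le> n" "0 < n"
  shows "r ^ (j choose m) \<le> (r powr ((n choose m) / n)) ^ j"
proof -
  have "real n * real (j choose m) \<le> real j * real (n choose m)"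
    using times_binomial_le_times_binomial[OF assms(2,3)]
    by (metis of_nat_le_iff of_nat_mult)
  then have "real (j choose m) \<le> (n choose m) / n * j"
    using assms by (simp add: field_simps)
  then have "r powr real (j choose m) \<le> r powr ((n choose m) / n * j)"
    using assms by (intro powr_mono) auto
  then show ?thesis
    using assms by (simp add: powr_realpow powr_powr flip: powr_realpow)
qed

text \<open>After division by \<open>t ^ n\<close>, the left side is at most
  \<open>exp (n / t)\<close>, and \<open>n / t < 1 / 2\<close>.\<close>

lemma one_plus_power_less_double:
  fixes t :: real
  assumes "0 < n" "2 * n < t"
  shows "(1 + t) ^ n < 2 * t ^ n"
proof -
  have t: "0 < t" using assms by linarith
  have "(1 + 1 / t) ^ n \<le> exp (1 / t) ^ n"
    using t by (intro power_mono) auto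
  also have "\<dots> = exp (n / t)"
    by (simp flip: exp_of_nat_mult)
  also have "\<dots> < exp (1 / 2)"
    using assms t by (simp add: field_simps)
  also have "\<dots> \<le> 2"
    by (rule exp_half_le2)
  finally have "(1 + 1 / t) ^ n * t ^ n < 2 * t ^ n"
    using t by simp
  moreover have "(1 + 1 / t) * t = 1 + t"
    using t by (simp add: field_simps)
  ultimately show ?thesis
    by (simp flip: power_mult_distrib)
qed

theorem corollary5p2:
  fixes m n :: nat and z :: complex
  assumes "m \<ge> 3" and "n \<ge> 2 * m + 1" and "poly (f_poly m n) z = 0"
  shows "cmod z < 1 + fact m / (real n - real m) ^ (m - 2)"
proof (rule ccontr)
  define r where "r = cmod z"
  define d where "d = fact m / (real n - real m) ^ (m - 2)"
  define K where "K = real (n choose m) / real n"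
  define t where "t = r powr K"
  assume "\<not> ?thesis"
  then have r: "1 + d \<le> r"
    by (simp add: r_def d_def)
  have n: "7 \<le> n" "m \<le> n" "m < n"
    using assms by auto
  have d: "0 \<le> d"
    using n by (simp add: d_def)
  have r1: "1 \<le> r"
    using r d by simp
  have K: "2 \<le> K"
  proof -
    have "2 * n \<le> n choose m"
      using assms by (intro binomial_ge_double) auto
    then have "2 * real n \<le> n choose m"
      by linarith
    then show ?thesis
      using n by (simp add: K_def field_simps)
  qed
  have Kd: "real n - 1 \<le> K * d"
  proof -
    have "real (n * (n - 1) * (n - m) ^ (m - 2)) \<le> real (fact m * (n choose m))"
      using assms n by (intro of_nat_mono fact_times_binomial_ge) auto
    then have "real n * (real n - 1) * (real n - real m) ^ (m - 2) \<le> fact m * real (n choose m)"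
      using n by (simp add: of_nat_diff)
    then show ?thesis
      using n by (simp add: K_def d_def field_simps)
  qed
  have t: "2 * real n < t"
  proof -
    \<comment> \<open>Bernoulli with exponent \<open>K\<close> would give only
      \<open>t \<ge> n\<close>. Using \<open>K / 2\<close>, which is at least 1 because
      \<open>2 \<le> K\<close>, and then squaring gives a quadratic bound.\<close>
    have "(real n + 1) / 2 \<le> 1 + (K / 2) * d"
      using Kd by simp
    also have "\<dots> \<le> (1 + d) powr (K / 2)"
      using K d by (intro Bernoulli_inequality_powr) auto
    also have "\<dots> \<le> r powr (K / 2)"
      using r d K by (intro powr_mono2) auto
    finally have "((real n + 1) / 2)\<^sup>2 \<le> (r powr (K / 2))\<^sup>2"
      by (intro power_mono) auto
    also have "\<dots> = t"
      using r1 by (simp add: t_def power2_eq_square flip: powr_add)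
    finally have *: "((real n + 1) / 2)\<^sup>2 \<le> t" .
    \<comment> \<open>The added term is positive because \<open>7 \<le> n\<close>, which comes from
      \<open>m \<ge> 3\<close>.\<close>
    have "2 * real n < 2 * real n + (real n * (real n - 6) + 1) / 4"
      using n by (simp add: add_nonneg_pos)
    also have "\<dots> = ((real n + 1) / 2)\<^sup>2"
      by (simp add: power2_eq_square field_simps)
    finally show ?thesis
      using * by simp
  qed
  \<comment> \<open>The exponent \<open>K\<close> is chosen so that the bound on the terms is an
    equality at \<open>j = n\<close>, where the coefficient is 1.\<close>
  have tn: "t ^ n = r ^ (n choose m)"
    using n r1 by (simp add: t_def K_def powr_powr flip: powr_realpow)
  have "(\<Sum>j\<le>n. of_nat (n choose j) * z ^ (j choose m)) = 0"
    using assms(3) by (simp add: f_poly_def poly_sum poly_monom atLeast0AtMost)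
  then have "z ^ (n choose m) = - (\<Sum>j<n. of_nat (n choose j) * z ^ (j choose m))"
    by (simp add: lessThan_Suc_atMost[symmetric] eq_neg_iff_add_eq_0 add.commute)
  then have "r ^ (n choose m) = norm (\<Sum>j<n. of_nat (n choose j) * z ^ (j choose m))"
    by (metis norm_minus_cancel norm_power r_def)
  also have "\<dots> \<le> (\<Sum>j<n. (n choose j) * r ^ (j choose m))"
    by (rule sum_norm_le) (simp add: norm_mult norm_power r_def)
  also have "\<dots> \<le> (\<Sum>j<n. (n choose j) * t ^ j)"
    unfolding t_def K_def using r1 n assms
    by (intro sum_mono mult_left_mono power_binomial_le) auto
  \<comment> \<open>This is the binomial expansion of \<open>(1 + t) ^ n\<close> without its top
    term.\<close>
  also have "\<dots> = (1 + t) ^ n - t ^ n"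
    using binomial_ring[of t 1 n]
    by (simp add: lessThan_Suc_atMost[symmetric] add.commute)
  also have "\<dots> < t ^ n"
    using one_plus_power_less_double[of n t] t n by simp
  finally show False
    by (simp add: tn)
qed

end
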